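(* Let $p_1,p_2,p_3\in\{3,4,5,\dots\}\cup\{\infty\}$, let $(C_1,C_2,C_3)$ be a complex hyperbolic $(p_1,p_2,p_3)$-triangle with angular invariant $\alpha$, and let $\iota_1,\iota_2,\iota_3\in \mathrm{SU}(2,1)$ be the complex reflections in its sides. Let $a=(a_1,\dots,a_n)$ be a word of length $n\ge3$ with letters in $\{1,2,3\}$. Then $$\tau_a=-(\tau_{\delta a}+\tau_{\delta''a}+\tau_{\delta\delta''a})+\beta(\tau_{\delta'a}+\tau_{\delta\delta'a}+\tau_{\delta'\delta''a}+\tau_{\delta\delta'\delta''a}),$$ where $$\beta=2r_1^{v_1(T)}r_2^{v_2(T)}r_3^{v_3(T)}\cdot e^{i\alpha w(T)}-1$$ with $T=(a_{n-2},a_{n-1},a_n)$.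
   Context: $\mathbb C^{2,1}$ is $\mathbb C^3$ with the Hermitian form $\langle z,w\rangle=z_1\bar w_1+z_2\bar w_2-z_3\bar w_3$. The complex hyperbolic plane $H^2_{\mathbb C}$ is the projectivisation of the set of vectors with $\langle z,z\rangle<0$; its ideal boundary is the projectivisation of the set of nonzero null vectors. A complex geodesic $C$ is the projectivisation (intersected with $H^2_{\mathbb C}$) of the orthogonal complement of a vector $c$ with $\langle c,c\rangle>0$; $c$ is called a polar vector of $C$, normalised if $\langle c,c\rangle=1$. Two complex geodesics with normalised polar vectors $c,c'$ meet in $H^2_{\mathbb C}$ at angle $\varphi\in(0,\pi/2]$ iff $|\langle c,c'\rangle|=\cos\varphi<1$; distinct complex geodesics have closures meeting in one point of the ideal boundary ("angle $0$") iff $|\langle c,c'\rangle|=1$. A complex hyperbolic triangle is a triple $(C_1,C_2,C_3)$ of complex geodesics; $c_k$ denotes a normalised polar vector of $C_k$ and $r_k=|\langle c_{k-1},c_{k+1}\rangle|$. All indices are mod 3. It is a $(p_1,p_2,p_3)$-triangle if $C_{k-1}$ and $C_{k+1}$ meet at angle $\pi/p_k$ for each $k$ (with $\pi/\infty=0$), so that $r_k=\cos(\pi/p_k)$. The angular invariant is $\alpha=\arg\left(\prod_{k=1}^3\langle c_{k-1},c_{k+1}\rangle\right)$ (mod $2\pi$). The complex reflection in $C_k$ is represented by $\iota_k\in\mathrm{SU}(2,1)$, $\iota_k(z)=-z+2\langle z,c_k\rangle c_k$. For a word $b=(b_1,\dots,b_m)$ in the letters $1,2,3$, $\iota_b=\iota_{b_1}\cdots\iota_{b_m}$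 and $\tau_b=\operatorname{trace}(\iota_b)$; the empty word gives the identity. Deletion operators: $\delta$ deletes the last letter, $\delta'$ the second-to-last letter, and $\delta''$ the third-to-last letter of a word, i.e. $\delta(a)=(a_1,\dots,a_{n-3},a_{n-2},a_{n-1})$, $\delta'(a)=(a_1,\dots,a_{n-3},a_{n-2},a_n)$, $\delta''(a)=(a_1,\dots,a_{n-3},a_{n-1},a_n)$. Products of these symbols denote compositions, the rightmost applied first. Winding number: $w(b_1,\dots,b_m)=\frac13\sum_{j=1}^m\chi(b_{j+1}-b_j)$ with $b_{m+1}:=b_1$, where $\chi(x)\in\{-1,0,1\}$ is congruent to $x$ modulo $3$. Also $v_k(x,y,z)=\psi_k(x,y)+\psi_k(y,z)-\psi_k(x,z)$, where $\psi_k(x,y)=1$ if $\{x,y\}=\{k-1,k+1\}$ (with $k\pm1$ taken mod 3 in $\{1,2,3\}$) and $\psi_k(x,y)=0$ otherwise. *)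

theory Defs
  imports "HOL-Analysis.Analysis" "HOL-Library.Extended_Nat"
begin

text \<open>
  The type \<open>3\<close> is the ring of integers modulo 3 with elements \<open>1\<close>, \<open>2\<close>, \<open>3 = 0\<close>. It serves as index
  set of coordinates, sides and letters, so that \<open>k - 1\<close> and \<open>k + 1\<close> are automatically read modulo 3.
\<close>

definition herm :: "complex^3 \<Rightarrow> complex^3 \<Rightarrow> complex" where
  "herm z w = z$1 * cnj (w$1) + z$2 * cnj (w$2) - z$3 * cnj (w$3)"

text \<open>Points of the projective plane are lines through the origin, as sets of vectors.\<close>

definition proj_pt :: "complex^3 \<Rightarrow> (complex^3) set" where
  "proj_pt z = range (\<lambda>t::complex. t *s z)"

text \<open>\<open>herm z z\<close> is real, so taking its real part loses nothing.\<close>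

definition hyp_plane :: "(complex^3) set set" where
  "hyp_plane = {proj_pt z |z. Re (herm z z) < 0}"

definition ideal_boundary :: "(complex^3) set set" where
  "ideal_boundary = {proj_pt z |z. z \<noteq> 0 \<and> herm z z = 0}"

definition polar_vector :: "complex^3 \<Rightarrow> (complex^3) set set \<Rightarrow> bool" where
  "polar_vector c C \<longleftrightarrow>
     Re (herm c c) > 0 \<and> C = {L \<in> hyp_plane. \<forall>z\<in>L. herm z c = 0}"

definition normalised_polar_vector :: "complex^3 \<Rightarrow> (complex^3) set set \<Rightarrow> bool" where
  "normalised_polar_vector c C \<longleftrightarrow> polar_vector c C \<and> herm c c = 1"

definition complex_geodesic :: "(complex^3) set set \<Rightarrow> bool" where
  "complex_geodesic C \<longleftrightarrow> (\<exists>c. polar_vector c C)"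

text \<open>
  Closure in the union of the hyperbolic plane and its ideal boundary: for the quotient topology,
  a point of projective space is in the closure of \<open>C\<close> iff, as a line in \<open>\<complex>\<^sup>3\<close>, it is
  contained in the closure of the cone \<open>\<Union>C\<close>.
\<close>

definition geodesic_closure :: "(complex^3) set set \<Rightarrow> (complex^3) set set" where
  "geodesic_closure C = {L \<in> hyp_plane \<union> ideal_boundary. L \<subseteq> closure (\<Union>C)}"

definition asymptotic :: "(complex^3) set set \<Rightarrow> (complex^3) set set \<Rightarrow> bool" where
  "asymptotic C C' \<longleftrightarrow> complex_geodesic C \<and> complex_geodesic C' \<and> C \<noteq> C' \<and>
     (\<exists>L\<in>ideal_boundary. geodesic_closure C \<inter> geodesic_closure C' = {L})"

text \<open>
  Normalised polar vectors exist and are unique up to a unit factor, so the universal quantifier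
  below only expresses independence of the choice.
\<close>

definition meet_at_angle :: "(complex^3) set set \<Rightarrow> (complex^3) set set \<Rightarrow> real \<Rightarrow> bool" where
  "meet_at_angle C C' \<phi> \<longleftrightarrow>
     complex_geodesic C \<and> complex_geodesic C' \<and>
     (if \<phi> = 0 then asymptotic C C'
      else 0 < \<phi> \<and> \<phi> \<le> pi/2 \<and> C \<inter> C' \<noteq> {} \<and>
        (\<forall>c c'. normalised_polar_vector c C \<longrightarrow> normalised_polar_vector c' C' \<longrightarrow>
           cmod (herm c c') = cos \<phi>))"

definition pi_over :: "enat \<Rightarrow> real" where
  "pi_over p = (case p of enat n \<Rightarrow> pi / real n | \<infinity> \<Rightarrow> 0)"

definition hyp_triangle :: "(3 \<Rightarrow> enat) \<Rightarrow> (3 \<Rightarrow> (complex^3) set set) \<Rightarrow> bool" where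
  "hyp_triangle p C \<longleftrightarrow> (\<forall>k. complex_geodesic (C k)) \<and>
     (\<forall>k. meet_at_angle (C (k - 1)) (C (k + 1)) (pi_over (p k)))"

definition side_param :: "(3 \<Rightarrow> complex^3) \<Rightarrow> 3 \<Rightarrow> real" where
  "side_param c k = cmod (herm (c (k - 1)) (c (k + 1)))"

text \<open>The angular invariant is only defined modulo \<open>2 * pi\<close>; \<open>\<alpha>\<close> is any representative.\<close>

definition angular_invariant :: "(3 \<Rightarrow> complex^3) \<Rightarrow> real \<Rightarrow> bool" where
  "angular_invariant c \<alpha> \<longleftrightarrow> is_Arg (\<Prod>k\<in>UNIV. herm (c (k - 1)) (c (k + 1))) \<alpha>"

definition complex_reflection :: "complex^3 \<Rightarrow> complex^3^3" where
  "complex_reflection c = matrix (\<lambda>z. - z + (2 * herm z c) *s c)"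

definition word_matrix :: "(3 \<Rightarrow> complex^3) \<Rightarrow> 3 list \<Rightarrow> complex^3^3" where
  "word_matrix c b = foldr (\<lambda>k M. complex_reflection (c k) ** M) b (mat 1)"

definition word_trace :: "(3 \<Rightarrow> complex^3) \<Rightarrow> 3 list \<Rightarrow> complex" where
  "word_trace c b = trace (word_matrix c b)"

text \<open>
  Deletion of the last, second-to-last and third-to-last letter; meaningful on words of length at
  least 1, 2 and 3, respectively.
\<close>

definition del1 :: "'a list \<Rightarrow> 'a list" where
  "del1 a = take (length a - 1) a"

definition del2 :: "'a list \<Rightarrow> 'a list" where
  "del2 a = take (length a - 2) a @ drop (length a - 1) a"

definition del3 :: "'a list \<Rightarrow> 'a list" where
  "del3 a = take (length a - 3) a @ drop (length a - 2) a"

definition residue_sign :: "3 \<Rightarrow> int" where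
  "residue_sign x = (if x = 0 then 0 else if x = 1 then 1 else - 1)"

definition winding :: "3 list \<Rightarrow> real" where
  "winding b = 1/3 * (\<Sum>j<length b. real_of_int (residue_sign (b ! (Suc j mod length b) - b ! j)))"

definition psi :: "3 \<Rightarrow> 3 \<Rightarrow> 3 \<Rightarrow> int" where
  "psi k x y = (if {x, y} = {k - 1, k + 1} then 1 else 0)"

definition vexp :: "3 \<Rightarrow> 3 \<Rightarrow> 3 \<Rightarrow> 3 \<Rightarrow> int" where
  "vexp k x y z = psi k x y + psi k y z - psi k x z"

definition beta :: "(3 \<Rightarrow> complex^3) \<Rightarrow> real \<Rightarrow> 3 \<Rightarrow> 3 \<Rightarrow> 3 \<Rightarrow> complex" where
  "beta c \<alpha> x y z =
     2 * complex_of_real (side_param c 1 powi vexp 1 x y z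
        * side_param c 2 powi vexp 2 x y z
        * side_param c 3 powi vexp 3 x y z)
     * exp (\<i> * complex_of_real (\<alpha> * winding [x, y, z])) - 1"

end

theory Submission
  imports Defs
begin

text \<open>
  Write \<open>a = u @ [x, y, z]\<close> and let \<open>P\<^sub>k v = herm v (c k) *s c k\<close>, so that \<open>\<iota>\<^sub>k + 1 = 2 P\<^sub>k\<close>. Moving
  the terms without \<open>\<beta>\<close> to the left, the claim compares the traces of
  \<open>\<iota>\<^sub>u (\<iota>\<^sub>x + 1) \<iota>\<^sub>y (\<iota>\<^sub>z + 1)\<close> and \<open>\<beta> \<iota>\<^sub>u (\<iota>\<^sub>x + 1) (\<iota>\<^sub>z + 1)\<close>. As \<open>P\<^sub>x P\<^sub>z\<close> and \<open>P\<^sub>x P\<^sub>y P\<^sub>z\<close> have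
  rank at most one with the same kernel and image, these matrices agree as soon as
  \<open>(\<beta> + 1) \<langle>c\<^sub>z, c\<^sub>x\<rangle> = 2 \<langle>c\<^sub>z, c\<^sub>y\<rangle> \<langle>c\<^sub>y, c\<^sub>x\<rangle>\<close>. Since every \<open>r\<^sub>k\<close> is nonzero, this is what the
  definition of \<open>\<beta>\<close> says.
\<close>

section \<open>The Hermitian form and nonvanishing of \<open>side_param\<close>\<close>

lemma herm_add_left: "herm (u + v) w = herm u w + herm v w"
  by (simp add: herm_def algebra_simps)

lemma herm_scale_left: "herm (t *s v) w = t * herm v w"
  by (simp add: herm_def algebra_simps)

lemma herm_minus_left: "herm (- v) w = - herm v w"
  by (simp add: herm_def)

lemma herm_cnj: "cnj (herm v w) = herm w v"
  by (simp add: herm_def algebra_simps)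

lemma herm_scale_self: "herm (t *s z) (t *s z) = t * cnj t * herm z z"
  by (simp add: herm_def algebra_simps)

text \<open>Rescaling by \<open>t\<close> multiplies \<open>herm z z\<close> by
  \<open>t * cnj t\<close>, so every vector on a null line is null.\<close>

lemma hyp_plane_ideal_boundary_disjoint: "hyp_plane \<inter> ideal_boundary = {}"
proof -
  have False if eq: "proj_pt v = proj_pt w" and sgn: "Re (herm v v) < 0" "herm w w = 0" for v w
  proof -
    have "1 *s v \<in> proj_pt w"
      unfolding eq[symmetric] unfolding proj_pt_def by (rule rangeI)
    then obtain t where "v = t *s w"
      by (auto simp: proj_pt_def)
    then show False
      using sgn by (simp add: herm_scale_self)
  qed
  then show ?thesis
    unfolding hyp_plane_def ideal_boundary_def by blast
qed

text \<open>The witness is the Hermitian cross product of the two vectors.\<close>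

lemma orthogonal_negative_vector:
  assumes "herm c c = 1" "herm d d = 1" "herm c d = 0"
  obtains v where "herm v c = 0" "herm v d = 0" "herm v v = -1"
proof -
  define v :: "complex^3" where "v = vector
    [cnj (c$2 * d$3 - c$3 * d$2), cnj (c$3 * d$1 - c$1 * d$3), - cnj (c$1 * d$2 - c$2 * d$1)]"
  have "herm v c = 0" "herm v d = 0"
    by (simp_all add: v_def herm_def algebra_simps)
  \<comment> \<open>Lagrange identity of the cross product; for orthonormal \<open>c\<close> and
    \<open>d\<close> it gives \<open>-1\<close>.\<close>
  moreover have "herm v v = herm c d * herm d c - herm c c * herm d d"
    by (simp add: v_def herm_def algebra_simps)
  ultimately show ?thesis
    using assms that by simp
qed

lemma geodesic_subset_closure: "polar_vector c C \<Longrightarrow> C \<subseteq> geodesic_closure C"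
  unfolding polar_vector_def geodesic_closure_def
  using closure_subset[of "\<Union>C"] by blast

text \<open>Orthogonal polar vectors would make the geodesics cross inside \<open>hyp_plane\<close>,
  giving their closures a common point other than the single ideal one.\<close>

lemma asymptotic_polar_not_orthogonal:
  assumes "asymptotic C D" "normalised_polar_vector c C" "normalised_polar_vector d D"
  shows "herm c d \<noteq> 0"
proof
  assume "herm c d = 0"
  then obtain v where v: "herm v c = 0" "herm v d = 0" "herm v v = -1"
    using assms orthogonal_negative_vector unfolding normalised_polar_vector_def by metis
  have "proj_pt v \<in> hyp_plane"
    using v(3) unfolding hyp_plane_def by auto
  moreover have "proj_pt v \<in> C" "proj_pt v \<in> D"
    using assms(2,3) calculation v(1,2)
    by (auto simp: normalised_polar_vector_def polar_vector_def proj_pt_def herm_scale_left)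
  then have "proj_pt v \<in> geodesic_closure C \<inter> geodesic_closure D"
    using assms(2,3) geodesic_subset_closure unfolding normalised_polar_vector_def by blast
  moreover obtain L where "L \<in> ideal_boundary" "geodesic_closure C \<inter> geodesic_closure D = {L}"
    using assms(1) unfolding asymptotic_def by blast
  ultimately show False
    using hyp_plane_ideal_boundary_disjoint by auto
qed

text \<open>The exponents in \<open>beta\<close> can be \<open>-1\<close>, so the value 0 must be
  excluded. Angle 0 is the asymptotic case; otherwise \<open>3 \<le> p k\<close> keeps the angle
  below \<open>pi / 2\<close>, where the cosine is positive.\<close>

lemma side_param_nonzero:
  assumes "3 \<le> p k" "hyp_triangle p C" "\<And>k. normalised_polar_vector (c k) (C k)"
  shows "side_param c k \<noteq> 0"
proof (cases "pi_over (p k) = 0")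
  case True
  then have "asymptotic (C (k - 1)) (C (k + 1))"
    using assms(2) unfolding hyp_triangle_def meet_at_angle_def by metis
  then show ?thesis
    using asymptotic_polar_not_orthogonal assms(3) unfolding side_param_def by simp
next
  case False
  then obtain n where n: "p k = enat n"
    unfolding pi_over_def by (cases "p k") auto
  then have "3 \<le> n"
    using assms(1) by (simp add: numeral_eq_enat)
  then have "0 < pi / n" "pi / n < pi / 2"
    by (simp_all add: field_simps)
  then have "0 < cos (pi / n)"
    by (intro cos_gt_zero) auto
  moreover have "side_param c k = cos (pi / n)"
    using spec[OF conjunct2[OF assms(2)[unfolded hyp_triangle_def]], of k] assms(3) False
    unfolding meet_at_angle_def side_param_def n pi_over_def by simp
  ultimately show ?thesis by simp
qed

section \<open>Indices modulo 3 and the value of \<open>beta\<close>\<close>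

lemma three_neq: "(1::3) \<noteq> 2" "(2::3) \<noteq> 1" "(1::3) \<noteq> 3" "(3::3) \<noteq> 1" "(2::3) \<noteq> 3" "(3::3) \<noteq> 2"
  by simp_all

lemma three_succ_pred: "(1::3) - 1 = 3" "(2::3) - 1 = 1" "(3::3) - 1 = 2"
  "(1::3) + 1 = 2" "(2::3) + 1 = 3" "(3::3) + 1 = 1"
  by simp_all

lemma residue_sign_diff:
  "residue_sign (k - k) = 0"
  "residue_sign (2 - 1) = 1" "residue_sign (3 - 2) = 1" "residue_sign (1 - 3) = 1"
  "residue_sign (1 - 2) = -1" "residue_sign (2 - 3) = -1" "residue_sign (3 - 1) = -1"
  by (simp_all add: residue_sign_def)

lemma winding_three:
  "winding [x, y, z] = (residue_sign (y - x) + residue_sign (z - y) + residue_sign (x - z)) / 3"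
proof -
  have "{..<length [x, y, z]} = {0, 1, 2}"
    by auto
  then show ?thesis
    by (simp add: winding_def)
qed

lemma psi_eq:
  "psi 1 x y = (if x = 3 \<and> y = 2 \<or> x = 2 \<and> y = 3 then 1 else 0)"
  "psi 2 x y = (if x = 1 \<and> y = 3 \<or> x = 3 \<and> y = 1 then 1 else 0)"
  "psi 3 x y = (if x = 2 \<and> y = 1 \<or> x = 1 \<and> y = 2 then 1 else 0)"
  by (simp_all only: psi_def doubleton_eq_iff three_succ_pred)

text \<open>If two of the letters agree, the winding number is 0 and \<open>beta + 1\<close> is
  \<open>2\<close>, or \<open>2\<close> times a squared \<open>side_param\<close> when only
  \<open>x = z\<close>. For distinct letters the winding number is \<open>1\<close> or
  \<open>-1\<close>, and the exponents are 1, 1 for the pairs \<open>x, y\<close> and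
  \<open>y, z\<close> and \<open>-1\<close> for \<open>x, z\<close>.\<close>

lemma beta_herm:
  assumes unit: "\<And>k. herm (c k) (c k) = 1"
    and nz: "\<And>k. side_param c k \<noteq> 0"
    and ang: "angular_invariant c \<alpha>"
  shows "2 * herm (c z) (c y) * herm (c y) (c x) = (beta c \<alpha> x y z + 1) * herm (c z) (c x)"
proof -
  \<comment> \<open>\<open>A\<close>, \<open>B\<close>, \<open>D\<close> are the factors of the
    angular invariant for \<open>k = 1, 2, 3\<close>.\<close>
  define A where "A = herm (c 3) (c 2)"
  define B where "B = herm (c 1) (c 3)"
  define D where "D = herm (c 2) (c 1)"
  define E where "E = exp (\<i> * complex_of_real \<alpha>)"
  let ?n = "\<lambda>w. complex_of_real (cmod w)"
  have h: "herm (c 3) (c 2) = A" "herm (c 2) (c 3) = cnj A" "herm (c 1) (c 3) = B"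
    "herm (c 3) (c 1) = cnj B" "herm (c 2) (c 1) = D" "herm (c 1) (c 2) = cnj D"
    by (simp_all only: A_def B_def D_def herm_cnj)
  have r: "side_param c 1 = cmod A" "side_param c 2 = cmod B" "side_param c 3 = cmod D"
    unfolding side_param_def three_succ_pred h by simp_all
  have n0: "A \<noteq> 0" "B \<noteq> 0" "D \<noteq> 0"
    using nz[of 1] nz[of 2] nz[of 3] unfolding r by simp_all
  have sq: "?n w * ?n w = w * cnj w" for w
    using complex_norm_square[of w] by (simp add: power2_eq_square)
  have "A * B * D = ?n (A * B * D) * E"
    using ang unfolding angular_invariant_def is_Arg_def UNIV_3 E_def
    by (simp only: three_succ_pred three_neq h prod.insert prod.empty finite.intros
        insert_iff empty_iff HOL.simp_thms mult_1_right mult.assoc)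
  then have E: "?n A * ?n B * ?n D * E = A * B * D"
    by (simp add: norm_mult)
  \<comment> \<open>Divide the product by \<open>V\<close>, writing \<open>1 / V\<close> as
    \<open>cnj V\<close> over the squared modulus of \<open>V\<close>.\<close>
  have cyclic: "U * W = ?n U * ?n W / ?n V * F * cnj V"
    if "?n U * ?n V * ?n W * F = U * V * W" "V \<noteq> 0" for U V W F
  proof -
    have "U * W * (V * ?n V) = ?n U * ?n W * F * (?n V * ?n V)"
      using that(1) by (simp add: algebra_simps)
    also have "\<dots> = ?n U * ?n W * F * cnj V * V"
      unfolding sq by simp
    finally show ?thesis
      using that(2) by (simp add: field_simps)
  qed
  have cE: "exp (- (\<i> * complex_of_real \<alpha>)) = cnj E"
    by (simp add: E_def exp_cnj)
  have pos: "A * D = ?n A * ?n D / ?n B * E * cnj B" "D * B = ?n D * ?n B / ?n A * E * cnj A"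
    "B * A = ?n B * ?n A / ?n D * E * cnj D"
    by (intro cyclic; use E n0 in \<open>simp add: ac_simps\<close>)+
  \<comment> \<open>Conjugation reverses the cyclic order: \<open>pos\<close> serves winding number
    \<open>1\<close>, \<open>neg\<close> serves \<open>-1\<close>.\<close>
  have neg: "cnj A * cnj D = ?n A * ?n D / ?n B * cnj E * B"
    "cnj D * cnj B = ?n D * ?n B / ?n A * cnj E * A"
    "cnj B * cnj A = ?n B * ?n A / ?n D * cnj E * D"
    using arg_cong[OF pos(1), of cnj] arg_cong[OF pos(2), of cnj] arg_cong[OF pos(3), of cnj]
    by simp_all
  have double: "2 * t * s = (2 * q * e - 1 + 1) * k" if "t * s = q * e * k" for t s q e k :: complex
    using that by simp
  note tables = beta_def vexp_def psi_eq winding_three residue_sign_diff three_neq r h unit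
  consider "x = y" | "y = z" | "x = z" "x \<noteq> y"
    | "x = 1 \<and> y = 2 \<and> z = 3 \<or> x = 2 \<and> y = 3 \<and> z = 1 \<or> x = 3 \<and> y = 1 \<and> z = 2"
    | "x = 3 \<and> y = 2 \<and> z = 1 \<or> x = 1 \<and> y = 3 \<and> z = 2 \<or> x = 2 \<and> y = 1 \<and> z = 3"
    using exhaust_3[of x] exhaust_3[of y] exhaust_3[of z] by blast
  then show ?thesis
  proof cases
    case 1
    show ?thesis
      using exhaust_3[of x] exhaust_3[of z] unfolding 1[symmetric]
      by (elim disjE; simp only: tables; simp)
  next
    case 2
    show ?thesis
      using exhaust_3[of x] exhaust_3[of y] unfolding 2[symmetric]
      by (elim disjE; simp only: tables; simp)
  next
    case 3
    then show ?thesis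
      using exhaust_3[of x] exhaust_3[of y] unfolding 3(1)[symmetric]
      by (elim disjE; simp only: tables; simp add: power2_eq_square sq mult.commute)
  next
    case 4
    then show ?thesis
      by (elim disjE conjE; hypsubst; unfold beta_def; intro double; simp only: tables;
        insert pos; simp add: E_def[symmetric] power_int_minus field_simps)
  next
    case 5
    then show ?thesis
      by (elim disjE conjE; hypsubst; unfold beta_def; intro double; simp only: tables;
        insert neg; simp add: cE power_int_minus field_simps)
  qed
qed

section \<open>Reflections as matrices\<close>

lemma reflection_mult_vec: "complex_reflection c *v v = - v + (2 * herm v c) *s c"
proof -
  \<comment> \<open>\<open>matrix\<close> represents only linear maps; here linearity comes from the
    first argument of \<open>herm\<close>.\<close>
  have "Vector_Spaces.linear (*s) (*s) (\<lambda>z. - z + (2 * herm z c) *s c)"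
    by unfold_locales
      (simp_all add: herm_add_left herm_scale_left vec_eq_iff algebra_simps)
  then show ?thesis
    unfolding complex_reflection_def by (rule matrix_works)
qed

lemma reflection_plus_one_mult_vec: "(complex_reflection c + mat 1) *v v = (2 * herm v c) *s c"
  by (simp add: matrix_vector_mult_add_rdistrib reflection_mult_vec)

lemma scalar_mult_vec: "mat \<beta> *v v = \<beta> *s (v :: complex^'n)"
  by (simp add: vec_eq_iff matrix_vector_mult_def mat_def if_distrib if_distribR sum.delta' cong: if_cong)

lemma matrix_add_rdistrib: "(A + B) ** M = A ** M + B ** (M :: 'a::semiring_1^'n^'m)"
  by (simp add: matrix_matrix_mult_def vec_eq_iff sum.distrib distrib_right)

lemma trace_mult_scalar: "trace (U ** (mat \<beta> ** M)) = \<beta> * trace (U ** (M :: complex^'n^'n))"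
proof -
  have "U ** (mat \<beta> ** M) = (\<chi> i j. \<beta> * (U ** M) $ i $ j)"
    by (simp add: vec_eq_iff matrix_matrix_mult_def mat_def if_distrib if_distribR sum.delta'
      sum_distrib_left algebra_simps cong: if_cong)
  then show ?thesis
    by (simp add: trace_def sum_distrib_left)
qed

lemma reflection_sandwich:
  assumes "2 * herm cz cy * herm cy cx = (\<beta> + 1) * herm cz cx"
  shows "(complex_reflection cx + mat 1) ** complex_reflection cy ** (complex_reflection cz + mat 1)
    = mat \<beta> ** ((complex_reflection cx + mat 1) ** (complex_reflection cz + mat 1))"
    (is "?L = ?R")
proof -
  have "?L *v v = ?R *v v" for v
  proof -
    \<comment> \<open>The outer factors contribute \<open>2 * 2\<close>; the term
      \<open>- herm cz cx\<close> comes from the \<open>- z\<close> in the middle reflection and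
      accounts for the \<open>+ 1\<close> in the assumption.\<close>
    have "?L *v v = (4 * herm v cz * (2 * herm cz cy * herm cy cx - herm cz cx)) *s cx"
      by (simp add: reflection_plus_one_mult_vec reflection_mult_vec scalar_mult_vec
        herm_add_left herm_minus_left herm_scale_left algebra_simps flip: matrix_vector_mul_assoc)
    also have "\<dots> = (4 * herm v cz * (\<beta> * herm cz cx)) *s cx"
      unfolding assms by (simp add: algebra_simps)
    also have "\<dots> = ?R *v v"
      by (simp add: reflection_plus_one_mult_vec scalar_mult_vec
        herm_scale_left mult_ac flip: matrix_vector_mul_assoc)
    finally show ?thesis .
  qed
  then show ?thesis
    by (simp add: matrix_eq)
qed

section \<open>Traces of words\<close>

lemma word_matrix_Nil [simp]: "word_matrix c [] = mat 1"
  by (simp add: word_matrix_def)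

lemma word_matrix_Cons [simp]: "word_matrix c (k # b) = complex_reflection (c k) ** word_matrix c b"
  by (simp add: word_matrix_def)

lemma word_matrix_append: "word_matrix c (b @ b') = word_matrix c b ** word_matrix c b'"
  by (induction b) (simp_all add: matrix_mul_assoc)

text \<open>Expanding the two brackets \<open>?R x + mat 1\<close> and \<open>?R z + mat 1\<close>
  yields the four words on each side.\<close>

lemma word_trace_relation:
  assumes "2 * herm (c z) (c y) * herm (c y) (c x) = (\<beta> + 1) * herm (c z) (c x)"
  shows "word_trace c (u @ [x, y, z]) + word_trace c (u @ [x, y]) + word_trace c (u @ [y, z])
      + word_trace c (u @ [y])
    = \<beta> * (word_trace c (u @ [x, z]) + word_trace c (u @ [x]) + word_trace c (u @ [z])
      + word_trace c u)"
proof -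
  let ?R = "\<lambda>k. complex_reflection (c k)" and ?U = "word_matrix c u"
  have "word_trace c (u @ [x, y, z]) + word_trace c (u @ [x, y]) + word_trace c (u @ [y, z])
      + word_trace c (u @ [y]) = trace (?U ** ((?R x + mat 1) ** ?R y ** (?R z + mat 1)))"
    by (simp add: word_trace_def word_matrix_append matrix_add_ldistrib matrix_add_rdistrib
      trace_add matrix_mul_assoc)
  also have "\<dots> = \<beta> * trace (?U ** ((?R x + mat 1) ** (?R z + mat 1)))"
    unfolding reflection_sandwich[OF assms] by (rule trace_mult_scalar)
  also have "\<dots> = \<beta> * (word_trace c (u @ [x, z]) + word_trace c (u @ [x]) + word_trace c (u @ [z])
      + word_trace c u)"
    by (simp add: word_trace_def word_matrix_append matrix_add_ldistrib matrix_add_rdistrib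
      trace_add matrix_mul_assoc)
  finally show ?thesis .
qed

lemma split_last_three:
  assumes "3 \<le> length a"
  obtains u x y z where "a = u @ [x, y, z]"
proof -
  have "length (drop (length a - 3) a) = 3"
    using assms by simp
  then obtain x y z where "drop (length a - 3) a = [x, y, z]"
    unfolding numeral_3_eq_3 length_Suc_conv by auto
  then show ?thesis
    using that append_take_drop_id by metis
qed

theorem theorem7:
  fixes p :: "3 \<Rightarrow> enat"
    and C :: "3 \<Rightarrow> (complex^3) set set"
    and c :: "3 \<Rightarrow> complex^3"
    and \<alpha> :: real
    and a :: "3 list"
  assumes "\<And>k. 3 \<le> p k"
    and "hyp_triangle p C"
    and "\<And>k. normalised_polar_vector (c k) (C k)"
    and "angular_invariant c \<alpha>"
    and "3 \<le> length a"
  shows "word_trace c a =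
     - (word_trace c (del1 a) + word_trace c (del3 a) + word_trace c (del1 (del3 a)))
     + beta c \<alpha> (a ! (length a - 3)) (a ! (length a - 2)) (a ! (length a - 1))
       * (word_trace c (del2 a) + word_trace c (del1 (del2 a))
          + word_trace c (del2 (del3 a)) + word_trace c (del1 (del2 (del3 a))))"
proof -
  obtain u x y z where a: "a = u @ [x, y, z]"
    using assms(5) by (rule split_last_three)
  have "2 * herm (c z) (c y) * herm (c y) (c x) = (beta c \<alpha> x y z + 1) * herm (c z) (c x)"
    using assms(3) side_param_nonzero[OF assms(1-3)] assms(4)
    unfolding normalised_polar_vector_def by (intro beta_herm) auto
  \<comment> \<open>The deletions give exactly these words; for instance
    \<open>del1 (del3 a)\<close> is \<open>u @ [y]\<close> and \<open>del2 (del3 a)\<close> is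
    \<open>u @ [z]\<close>.\<close>
  from word_trace_relation[of c, OF this, of u] show ?thesis
    by (simp add: a del1_def del2_def del3_def nth_append algebra_simps eval_nat_numeral)
qed

end
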